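(* Let $G$ be a Polish group, $X$ a Polish $G$-space and $x,y\in X$. If $x$ is left $\iota$-embeddable into $y$, then $x$ is right $\iota$-embeddable into $y$.
   Context: A Polish $G$-space is a Polish space with a continuous action of $G$. A sequence $(g_n)$ in $G$ is left Cauchy if $\lim_{m,n}g_m^{-1}g_n=1_G$ and right Cauchy if $\lim_{m,n}g_mg_n^{-1}=1_G$. $x$ is left $\iota$-embeddable into $y$ if there is a left Cauchy sequence $(g_n)$ in $G$ with $g_nx\to y$; $x$ is right $\iota$-embeddable into $y$ if there is a right Cauchy sequence $(h_n)$ in $G$ with $h_ny\to x$. *)

theory Defs
  imports "HOL-Analysis.Analysis" "HOL-Algebra.Group_Action"
begin

definition polish_topology :: "'a topology \<Rightarrow> bool" where
  "polish_topology X \<longleftrightarrow> completely_metrizable_space X \<and> separable_space X"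

locale topological_group = group G for G (structure) +
  fixes T :: "'a topology"
  assumes topspace_eq: "topspace T = carrier G"
    and continuous_mult: "continuous_map (prod_topology T T) T (\<lambda>(g, h). g \<otimes> h)"
    and continuous_inv: "continuous_map T T (\<lambda>g. inv g)"

locale polish_group = topological_group +
  assumes polish: "polish_topology T"

text \<open>The action is written \<open>\<phi> g x\<close>. The library's group actions are homomorphisms into
  \<^const>\<open>BijGroup\<close>, so \<open>\<phi> g\<close> is normalised to \<^const>\<open>undefined\<close> outside of the space.\<close>

locale polish_G_space = polish_group G T + group_action G "topspace X" \<phi>
  for G (structure) and T and X :: "'b topology" and \<phi> +
  assumes polish_space: "polish_topology X"
    and continuous_action: "continuous_map (prod_topology T X) X (\<lambda>(g, x). \<phi> g x)"

definition left_Cauchy ::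
    "('a, 'm) monoid_scheme \<Rightarrow> 'a topology \<Rightarrow> (nat \<Rightarrow> 'a) \<Rightarrow> bool" where
  "left_Cauchy G T g \<longleftrightarrow> range g \<subseteq> carrier G \<and>
     limitin T (\<lambda>(m, n). inv\<^bsub>G\<^esub> (g m) \<otimes>\<^bsub>G\<^esub> g n) \<one>\<^bsub>G\<^esub> (sequentially \<times>\<^sub>F sequentially)"

definition right_Cauchy ::
    "('a, 'm) monoid_scheme \<Rightarrow> 'a topology \<Rightarrow> (nat \<Rightarrow> 'a) \<Rightarrow> bool" where
  "right_Cauchy G T g \<longleftrightarrow> range g \<subseteq> carrier G \<and>
     limitin T (\<lambda>(m, n). g m \<otimes>\<^bsub>G\<^esub> inv\<^bsub>G\<^esub> (g n)) \<one>\<^bsub>G\<^esub> (sequentially \<times>\<^sub>F sequentially)"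

definition left_iota_embeddable ::
    "('a, 'm) monoid_scheme \<Rightarrow> 'a topology \<Rightarrow> 'b topology \<Rightarrow> ('a \<Rightarrow> 'b \<Rightarrow> 'b) \<Rightarrow> 'b \<Rightarrow> 'b \<Rightarrow> bool" where
  "left_iota_embeddable G T X \<phi> x y \<longleftrightarrow>
     (\<exists>g. left_Cauchy G T g \<and> limitin X (\<lambda>n. \<phi> (g n) x) y sequentially)"

text \<open>Here the sequence moves \<open>y\<close>, not \<open>x\<close>.\<close>

definition right_iota_embeddable ::
    "('a, 'm) monoid_scheme \<Rightarrow> 'a topology \<Rightarrow> 'b topology \<Rightarrow> ('a \<Rightarrow> 'b \<Rightarrow> 'b) \<Rightarrow> 'b \<Rightarrow> 'b \<Rightarrow> bool" where
  "right_iota_embeddable G T X \<phi> x y \<longleftrightarrow>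
     (\<exists>h. right_Cauchy G T h \<and> limitin X (\<lambda>n. \<phi> (h n) y) x sequentially)"

end

theory Submission
  imports Defs
begin

text \<open>If \<open>g\<^sub>n\<close> is left Cauchy, then \<open>g\<^sub>n\<^sup>-\<^sup>1\<close> is right Cauchy. If moreover \<open>g\<^sub>n x\<close> converges to \<open>y\<close>,
  then the points \<open>g\<^sub>m\<^sup>-\<^sup>1 g\<^sub>n x\<close> converge to \<open>x\<close> as \<open>m\<close> and \<open>n\<close> grow together, while for fixed \<open>m\<close>
  they converge to \<open>g\<^sub>m\<^sup>-\<^sup>1 y\<close>. As \<open>X\<close> is regular, the iterated limit \<open>lim g\<^sub>m\<^sup>-\<^sup>1 y\<close> exists and
  equals the double limit \<open>x\<close>.\<close>

lemma limitin_continuous_map_pair: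
  assumes continuous: "continuous_map (prod_topology X Y) Z (\<lambda>(x, y). f x y)"
    and "limitin X u a F" and "limitin Y v b F"
  shows "limitin Z (\<lambda>i. f (u i) (v i)) (f a b) F"
proof -
  have "limitin (prod_topology X Y) (\<lambda>i. (u i, v i)) (a, b) F"
    using assms by (simp add: limitin_pairwise o_def)
  from continuous_map_limit [OF continuous this] show ?thesis
    by (simp add: o_def)
qed

lemma regular_space_closed_neighbourhood:
  assumes "regular_space X" and "openin X U" and "x \<in> U"
  obtains V C where "openin X V" and "closedin X C" and "x \<in> V" and "V \<subseteq> C" and "C \<subseteq> U"
  using assms unfolding neighbourhood_base_of_closedin [symmetric] neighbourhood_base_of
  by metis

lemma limitin_iterated_limit:
  assumes regular: "regular_space X"
    and double_limit: "limitin X (\<lambda>(m, n). f m n) x (F \<times>\<^sub>F F')"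
    and inner_limit: "\<forall>\<^sub>F m in F. limitin X (f m) (l m) F'"
    and nontrivial: "F' \<noteq> bot"
  shows "limitin X l x F"
  unfolding limitin_def
proof (intro conjI allI impI)
  show "x \<in> topspace X"
    using double_limit by (rule limitin_topspace)
next
  fix U assume "openin X U \<and> x \<in> U"
  then obtain V C where "openin X V" "x \<in> V" "V \<subseteq> C" and "closedin X C" "C \<subseteq> U"
    using regular_space_closed_neighbourhood [OF regular] by metis
  have "\<forall>\<^sub>F (m, n) in F \<times>\<^sub>F F'. f m n \<in> V"
    using double_limit \<open>openin X V\<close> \<open>x \<in> V\<close> by (simp add: limitin_def case_prod_unfold)
  then have "\<forall>\<^sub>F m in F. \<forall>\<^sub>F n in F'. f m n \<in> V"
    by (auto dest: eventually_eventually_prod_filter1)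
  with inner_limit show "\<forall>\<^sub>F m in F. l m \<in> U"
  proof eventually_elim
    case (elim m)
    from elim(2) have "\<forall>\<^sub>F n in F'. f m n \<in> C"
      using \<open>V \<subseteq> C\<close> by (auto elim: eventually_mono)
    with elim(1) \<open>closedin X C\<close> have "l m \<in> C"
      using nontrivial by (rule limitin_closedin)
    then show "l m \<in> U"
      using \<open>C \<subseteq> U\<close> by blast
  qed
qed

lemma polish_imp_regular_space: "polish_topology X \<Longrightarrow> regular_space X"
  by (simp add: polish_topology_def completely_metrizable_imp_metrizable_space
      metrizable_imp_regular_space)

lemma left_Cauchy_in_carrier: "left_Cauchy G T g \<Longrightarrow> g n \<in> carrier G"
  by (auto simp: left_Cauchy_def)

lemma (in group) left_Cauchy_imp_right_Cauchy_inv: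
  assumes "left_Cauchy G T g"
  shows "right_Cauchy G T (\<lambda>n. inv (g n))"
  using assms left_Cauchy_in_carrier [OF assms]
  by (auto simp: left_Cauchy_def right_Cauchy_def)

lemma (in group_action) action_one: "x \<in> E \<Longrightarrow> \<phi> \<one> x = x"
  by (simp flip: id_eq_one)

locale topological_G_space = topological_group G T + group_action G "topspace X" \<phi>
  for G (structure) and T and X :: "'b topology" and \<phi> +
  assumes continuous_action: "continuous_map (prod_topology T X) X (\<lambda>(g, x). \<phi> g x)"
begin

lemma limitin_action:
  assumes "limitin T g a F" and "limitin X u b F"
  shows "limitin X (\<lambda>i. \<phi> (g i) (u i)) (\<phi> a b) F"
  using continuous_action assms by (rule limitin_continuous_map_pair)

lemma limitin_left_Cauchy_double_action:
  assumes Cauchy: "left_Cauchy G T g" and in_space: "x \<in> topspace X"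
  shows "limitin X (\<lambda>(m, n). \<phi> (inv (g m)) (\<phi> (g n) x)) x (sequentially \<times>\<^sub>F sequentially)"
proof -
  have "limitin T (\<lambda>(m, n). inv (g m) \<otimes> g n) \<one> (sequentially \<times>\<^sub>F sequentially)"
    using Cauchy by (simp add: left_Cauchy_def)
  then have "limitin X (\<lambda>p. \<phi> (case p of (m, n) \<Rightarrow> inv (g m) \<otimes> g n) x) (\<phi> \<one> x)
      (sequentially \<times>\<^sub>F sequentially)"
    using in_space by (intro limitin_action) auto
  then show ?thesis
    by (simp add: case_prod_unfold composition_rule [OF in_space] action_one [OF in_space]
        left_Cauchy_in_carrier [OF Cauchy])
qed

lemma limitin_left_Cauchy_inv_action:
  assumes "regular_space X" and Cauchy: "left_Cauchy G T g" and "x \<in> topspace X"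
    and orbit_limit: "limitin X (\<lambda>n. \<phi> (g n) x) y sequentially"
  shows "limitin X (\<lambda>n. \<phi> (inv (g n)) y) x sequentially"
proof -
  have double_limit: "limitin X (\<lambda>(m, n). \<phi> (inv (g m)) (\<phi> (g n) x)) x
      (sequentially \<times>\<^sub>F sequentially)"
    using Cauchy \<open>x \<in> topspace X\<close> by (rule limitin_left_Cauchy_double_action)
  have "limitin X (\<lambda>n. \<phi> (inv (g m)) (\<phi> (g n) x)) (\<phi> (inv (g m)) y) sequentially" for m
    using orbit_limit left_Cauchy_in_carrier [OF Cauchy]
    by (intro limitin_action) (simp_all add: topspace_eq)
  then show ?thesis
    using limitin_iterated_limit [OF \<open>regular_space X\<close> double_limit] by simp
qed

lemma left_imp_right_iota_embeddable:
  assumes "regular_space X" and "x \<in> topspace X" and "left_iota_embeddable G T X \<phi> x y"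
  shows "right_iota_embeddable G T X \<phi> x y"
proof -
  obtain g where Cauchy: "left_Cauchy G T g" and "limitin X (\<lambda>n. \<phi> (g n) x) y sequentially"
    using assms by (auto simp: left_iota_embeddable_def)
  with assms have "limitin X (\<lambda>n. \<phi> (inv (g n)) y) x sequentially"
    by (intro limitin_left_Cauchy_inv_action)
  moreover have "right_Cauchy G T (\<lambda>n. inv (g n))"
    using Cauchy by (rule left_Cauchy_imp_right_Cauchy_inv)
  ultimately show ?thesis
    by (auto simp: right_iota_embeddable_def)
qed

end

sublocale polish_G_space \<subseteq> topological_G_space
  by unfold_locales (rule continuous_action)

theorem theorem4p2:
  fixes G :: "('a, 'm) monoid_scheme" and T :: "'a topology"
    and X :: "'b topology" and \<phi> :: "'a \<Rightarrow> 'b \<Rightarrow> 'b" and x y :: 'b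
  assumes "polish_group G T"
    and "polish_G_space G T X \<phi>"
    and "x \<in> topspace X" and "y \<in> topspace X"
    and "left_iota_embeddable G T X \<phi> x y"
  shows "right_iota_embeddable G T X \<phi> x y"
proof -
  interpret polish_G_space G T X \<phi> by fact
  have "regular_space X"
    using polish_space by (rule polish_imp_regular_space)
  then show ?thesis
    using \<open>x \<in> topspace X\<close> \<open>left_iota_embeddable G T X \<phi> x y\<close>
    by (rule left_imp_right_iota_embeddable)
qed

end
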